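(* Let $\psi$ be any Orlicz function and let $\mathcal{X}_\psi=\{X:\|X\|_\psi\le1\}$ be the class of all real random variables (distributions) with Orlicz norm at most $1$. For any estimator $\widetilde\sigma_\psi=\widetilde\sigma_\psi(X_1,\ldots,X_n)$, i.e. any sequence (in $n$) of real-valued measurable functions of the sample, and any rate $r_n\to0$, $$\limsup_{n\to\infty}\ \sup_{X\in\mathcal{X}_\psi}P\Big(\big|\widetilde\sigma_\psi(X_1,\ldots,X_n)-\|X\|_\psi\big|>r_n\Big)=1,$$ where, for each $X\in\mathcal{X}_\psi$, $X_1,\ldots,X_n$ are i.i.d. copies of $X$.
   Context: An Orlicz function is a function $\psi:[0,\infty)\to[0,\infty)$ that is increasing and convex, with $\psi(0)=0$ and $\psi(x)\to\infty$ as $x\to\infty$. For a real random variable $X$, the Orlicz norm is $\|X\|_\psi=\inf\{\sigma>0 : \mathbb{E}\,\psi(|X|/\sigma)\le 1\}$ (with $\inf\emptyset=\infty$). *)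

theory Defs
  imports "HOL-Probability.Probability"
begin

(* Only the values on [0, \<infinity>) matter; "increasing" is read as non-decreasing. *)
definition orlicz_function :: "(real \<Rightarrow> real) \<Rightarrow> bool" where
  "orlicz_function \<psi> \<longleftrightarrow>
     (\<forall>x\<ge>0. \<psi> x \<ge> 0) \<and> mono_on {0..} \<psi> \<and> convex_on {0..} \<psi> \<and> \<psi> 0 = 0 \<and>
     filterlim \<psi> at_top at_top"

(* The expectation is a nonnegative integral, so it may be infinite; the infimum is taken in
   ennreal, where Inf {} = \<infinity>. *)
definition orlicz_norm :: "(real \<Rightarrow> real) \<Rightarrow> 'a measure \<Rightarrow> ('a \<Rightarrow> real) \<Rightarrow> ennreal" where
  "orlicz_norm \<psi> M X =
     Inf {ennreal \<sigma> |\<sigma>. \<sigma> > 0 \<and> (\<integral>\<^sup>+ \<omega>. ennreal (\<psi> (\<bar>X \<omega>\<bar> / \<sigma>)) \<partial>M) \<le> 1}"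

(* A real random variable is represented by its law \<mu>, i.e. by the identity on (\<real>, \<mu>).
   By orlicz_norm_law and prob_iid_sample below, the norm and the probabilities of events about
   an i.i.d. sample do not depend on the space carrying the random variables. *)
definition orlicz_class :: "(real \<Rightarrow> real) \<Rightarrow> real measure set" where
  "orlicz_class \<psi> =
     {\<mu>. prob_space \<mu> \<and> sets \<mu> = sets borel \<and> orlicz_norm \<psi> \<mu> (\<lambda>x. x) \<le> 1}"

lemma orlicz_norm_law:
  assumes \<psi>: "orlicz_function \<psi>" and X: "X \<in> borel_measurable M"
  shows "orlicz_norm \<psi> (distr M borel X) (\<lambda>x. x) = orlicz_norm \<psi> M X"
proof -
  have "mono (\<lambda>x. \<psi> (max 0 x))"
    using \<psi> by (auto simp: orlicz_function_def mono_def mono_on_def)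
  then have [measurable]: "(\<lambda>x. \<psi> (max 0 x)) \<in> borel_measurable borel"
    by (rule borel_measurable_mono)
  have "(\<integral>\<^sup>+ x. ennreal (\<psi> (\<bar>x\<bar> / \<sigma>)) \<partial>distr M borel X) =
        (\<integral>\<^sup>+ \<omega>. ennreal (\<psi> (\<bar>X \<omega>\<bar> / \<sigma>)) \<partial>M)" if "\<sigma> > 0" for \<sigma>
  proof -
    have "(\<lambda>x. ennreal (\<psi> (max 0 (\<bar>x\<bar> / \<sigma>)))) \<in> borel_measurable borel"
      by measurable
    then have "(\<lambda>x. ennreal (\<psi> (\<bar>x\<bar> / \<sigma>))) \<in> borel_measurable borel"
      using that by (simp add: max_def)
    then show ?thesis
      using X by (simp add: nn_integral_distr)
  qed
  then show ?thesis
    unfolding orlicz_norm_def by (intro arg_cong[where f = Inf]) auto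
qed

lemma (in prob_space) prob_iid_sample:
  fixes X :: "nat \<Rightarrow> 'a \<Rightarrow> real"
  assumes n: "n \<ge> 1"
    and ind: "indep_vars (\<lambda>_. borel) X {1..n}"
    and law: "\<And>i. i \<in> {1..n} \<Longrightarrow> distr M borel (X i) = \<mu>"
    and A: "A \<in> sets (\<Pi>\<^sub>M i\<in>{1..n}. \<mu>)"
  shows "emeasure (\<Pi>\<^sub>M i\<in>{1..n}. \<mu>) A =
         emeasure M {\<omega> \<in> space M. (\<lambda>i\<in>{1..n}. X i \<omega>) \<in> A}"
proof -
  have rv: "X i \<in> borel_measurable M" if "i \<in> {1..n}" for i
    using ind that by (auto simp: indep_vars_def)
  have sets_\<mu>: "sets \<mu> = sets borel"
    using law[of 1] n by (metis atLeastAtMost_iff order_refl sets_distr)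
  have "distr M (\<Pi>\<^sub>M i\<in>{1..n}. borel) (\<lambda>\<omega>. \<lambda>i\<in>{1..n}. X i \<omega>) =
        (\<Pi>\<^sub>M i\<in>{1..n}. distr M borel (X i))"
    using ind rv n
      indep_vars_iff_distr_eq_PiM'[where I = "{1..n}" and M' = "\<lambda>_. borel" and X = X]
    by simp
  also have "\<dots> = (\<Pi>\<^sub>M i\<in>{1..n}. \<mu>)"
    by (intro PiM_cong) (auto simp: law)
  finally have D: "distr M (\<Pi>\<^sub>M i\<in>{1..n}. borel) (\<lambda>\<omega>. \<lambda>i\<in>{1..n}. X i \<omega>) =
        (\<Pi>\<^sub>M i\<in>{1..n}. \<mu>)" .
  have "(\<lambda>\<omega>. \<lambda>i\<in>{1..n}. X i \<omega>) \<in> measurable M (\<Pi>\<^sub>M i\<in>{1..n}. borel)"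
    by (intro measurable_restrict rv)
  moreover have "sets (\<Pi>\<^sub>M i\<in>{1..n}. \<mu>) = sets (\<Pi>\<^sub>M i\<in>{1..n}. borel)"
    by (intro sets_PiM_cong) (auto simp: sets_\<mu>)
  ultimately show ?thesis
    using A unfolding D[symmetric]
    by (auto simp: emeasure_distr intro!: arg_cong[where f = "emeasure M"])
qed

end

theory Submission
  imports Defs
begin

text \<open>
  A rare large value is invisible in the sample but decides the norm. Put mass \<open>1 / \<psi> y\<close> at
  \<open>\<sigma> * y\<close> and the rest at \<open>0\<close>: the Orlicz norm is exactly \<open>\<sigma>\<close>, whatever \<open>y\<close> is, while for
  \<open>y \<rightarrow> \<infinity>\<close> the sample is constantly \<open>0\<close> with probability tending to \<open>1\<close>. On the zero sample an
  estimator takes a single value, which is at distance at least \<open>1/4\<close> from \<open>1/2\<close> or from \<open>1\<close>.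
\<close>

text \<open>As a pushforward of a Bernoulli law, it turns an integral against it into a sum of two
  terms.\<close>

definition two_point_law :: "real \<Rightarrow> real \<Rightarrow> real measure" where
  "two_point_law p a = distr (measure_pmf (bernoulli_pmf p)) borel (\<lambda>b. if b then a else 0)"

lemma sets_two_point_law [measurable_cong]: "sets (two_point_law p a) = sets borel"
  by (simp add: two_point_law_def)

lemma prob_space_two_point_law: "prob_space (two_point_law p a)"
  unfolding two_point_law_def by (intro measure_pmf.prob_space_distr) simp

lemma emeasure_two_point_law_0:
  assumes "0 \<le> p" "p \<le> 1" "a \<noteq> 0"
  shows "emeasure (two_point_law p a) {0} = ennreal (1 - p)"
proof -
  have "(\<lambda>b. if b then a else 0) -` {0} = {False}"
    using assms(3) by (auto split: if_splits)
  then show ?thesis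
    using assms by (simp add: two_point_law_def emeasure_distr emeasure_pmf_single)
qed

text \<open>Convexity on the segment from \<open>0\<close> to \<open>c * y\<close>, on which
  \<open>y\<close> sits at the fraction \<open>1 / c\<close>. This supplies strict growth wherever
  \<psi> is positive, which monotonicity in the weak sense does not.\<close>

lemma orlicz_function_mult_le:
  assumes \<psi>: "orlicz_function \<psi>" and "y \<ge> 0" "c \<ge> 1"
  shows "c * \<psi> y \<le> \<psi> (c * y)"
proof -
  have "convex_on {0..} \<psi>" and [simp]: "\<psi> 0 = 0"
    using \<psi> by (auto simp: orlicz_function_def)
  then have "\<psi> ((1 - 1 / c) *\<^sub>R 0 + (1 / c) *\<^sub>R (c * y)) \<le> (1 - 1 / c) * \<psi> 0 + (1 / c) * \<psi> (c * y)"
    using assms by (intro convex_onD) auto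
  then show ?thesis
    using assms by (simp add: field_simps)
qed

text \<open>The expectation at scale \<open>t\<close> is
  \<open>\<psi> (s / t * y) / \<psi> y\<close>, because the atom at \<open>0\<close> contributes
  nothing; the admissible scales are then exactly those with \<open>s \<le> t\<close>. The bound
  \<open>\<psi> y \<ge> 1\<close> makes \<open>1 / \<psi> y\<close> a probability.\<close>

lemma orlicz_norm_two_point_law:
  assumes \<psi>: "orlicz_function \<psi>" and y: "y > 0" "\<psi> y \<ge> 1" and s: "s > 0"
  shows "orlicz_norm \<psi> (two_point_law (1 / \<psi> y) (s * y)) (\<lambda>x. x) = ennreal s"
proof -
  have \<psi>_nonneg: "\<And>x. x \<ge> 0 \<Longrightarrow> \<psi> x \<ge> 0"
    and \<psi>_mono: "\<And>x z. 0 \<le> x \<Longrightarrow> x \<le> z \<Longrightarrow> \<psi> x \<le> \<psi> z" and [simp]: "\<psi> 0 = 0"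
    using \<psi> by (auto simp: orlicz_function_def mono_on_def)
  have int: "(\<integral>\<^sup>+ b. ennreal (\<psi> (\<bar>if b then s * y else 0\<bar> / t)) \<partial>bernoulli_pmf (1 / \<psi> y)) =
      ennreal (\<psi> (s / t * y) / \<psi> y)" if "t > 0" for t
    using that y s \<psi>_nonneg[of "s / t * y"]
    by (simp add: nn_integral_bernoulli_pmf ennreal_mult[symmetric])
  have "(\<integral>\<^sup>+ b. ennreal (\<psi> (\<bar>if b then s * y else 0\<bar> / t)) \<partial>bernoulli_pmf (1 / \<psi> y)) \<le> 1
      \<longleftrightarrow> s \<le> t" if "t > 0" for t
  proof -
    have "\<psi> (s / t * y) \<le> \<psi> y \<longleftrightarrow> s \<le> t"
    proof
      assume "s \<le> t"
      then show "\<psi> (s / t * y) \<le> \<psi> y"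
        using that y s by (intro \<psi>_mono) (auto simp: field_simps)
    next
      \<comment> \<open>For \<open>t < s\<close> the factor \<open>s / t\<close> exceeds
        \<open>1\<close>, and superlinearity pushes the value strictly above
        \<open>\<psi> y\<close>, which is positive.\<close>
      assume le: "\<psi> (s / t * y) \<le> \<psi> y"
      show "s \<le> t"
      proof (rule ccontr)
        assume "\<not> s \<le> t"
        then have c: "s / t > 1"
          using that by simp
        then have "s / t * \<psi> y \<le> \<psi> (s / t * y)"
          using y by (intro orlicz_function_mult_le[OF \<psi>]) auto
        moreover have "\<psi> y < s / t * \<psi> y"
          using mult_strict_right_mono[OF c, of "\<psi> y"] y by simp
        ultimately show False
          using le by linarith
      qed
    qed
    then show ?thesis
      using y by (simp add: int[OF that] divide_le_eq)
  qed
  then have "{ennreal t |t. t > 0 \<and>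
      (\<integral>\<^sup>+ b. ennreal (\<psi> (\<bar>if b then s * y else 0\<bar> / t)) \<partial>bernoulli_pmf (1 / \<psi> y)) \<le> 1}
      = {ennreal t |t. s \<le> t}"
    using s by fastforce
  moreover have "Inf {ennreal t |t. s \<le> t} = ennreal s"
    by (intro antisym Inf_lower Inf_greatest) (auto intro: ennreal_leI)
  ultimately show ?thesis
    unfolding two_point_law_def by (subst orlicz_norm_law[OF \<psi>]) (simp_all add: orlicz_norm_def)
qed

text \<open>The set \<open>A\<close> contains the zero sample, whose probability is
  \<open>(1 - p) ^ card I\<close> by independence; Bernoulli's inequality bounds this power from
  below.\<close>

lemma ennreal_one_minus_le_emeasure_PiM_two_point_law:
  assumes p: "0 \<le> p" "p \<le> 1" and "a \<noteq> 0" and "finite I"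
    and A: "A \<in> sets (\<Pi>\<^sub>M i\<in>I. two_point_law p a)" "(\<lambda>i\<in>I. 0) \<in> A"
  shows "ennreal (1 - real (card I) * p) \<le> emeasure (\<Pi>\<^sub>M i\<in>I. two_point_law p a) A"
proof -
  interpret product_prob_space "\<lambda>_. two_point_law p a" I
    by (intro product_prob_spaceI prob_space_two_point_law)
  have "1 + real (card I) * - p \<le> (1 + - p) ^ card I"
    using p by (intro Bernoulli_inequality) auto
  then have "ennreal (1 - real (card I) * p) \<le> ennreal ((1 - p) ^ card I)"
    by (intro ennreal_leI) simp
  also have "\<dots> = (\<Prod>i\<in>I. emeasure (two_point_law p a) {0})"
    using p \<open>a \<noteq> 0\<close> by (simp add: emeasure_two_point_law_0 ennreal_power)
  also have "\<dots> = emeasure (\<Pi>\<^sub>M i\<in>I. two_point_law p a) (\<Pi>\<^sub>E i\<in>I. {0})"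
    using \<open>finite I\<close> by (intro emeasure_PiM[symmetric]) (auto simp: sets_two_point_law)
  also have "\<dots> \<le> emeasure (\<Pi>\<^sub>M i\<in>I. two_point_law p a) A"
    using A by (intro emeasure_mono) (simp_all add: PiE_singleton restrict_def)
  finally show ?thesis .
qed

theorem theorem3p6:
  fixes \<psi> :: "real \<Rightarrow> real"
    and est :: "nat \<Rightarrow> (nat \<Rightarrow> real) \<Rightarrow> real"
    and r :: "nat \<Rightarrow> real"
  assumes "orlicz_function \<psi>"
    and "\<And>n. est n \<in> borel_measurable (\<Pi>\<^sub>M i\<in>{1..n}. (borel :: real measure))"
    and "r \<longlonglongrightarrow> 0"
  shows "limsup (\<lambda>n. SUP \<mu>\<in>orlicz_class \<psi>.
           emeasure (\<Pi>\<^sub>M i\<in>{1..n}. \<mu>)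
             {x \<in> space (\<Pi>\<^sub>M i\<in>{1..n}. \<mu>).
                \<bar>est n x - enn2real (orlicz_norm \<psi> \<mu> (\<lambda>y. y))\<bar> > r n}) = 1"
proof -
  define bad where "bad n \<mu> = {x \<in> space (\<Pi>\<^sub>M i\<in>{1..n}. \<mu>).
    \<bar>est n x - enn2real (orlicz_norm \<psi> \<mu> (\<lambda>y. y))\<bar> > r n}" for n \<mu>
  define risk where "risk n = (SUP \<mu>\<in>orlicz_class \<psi>. emeasure (\<Pi>\<^sub>M i\<in>{1..n}. \<mu>) (bad n \<mu>))" for n
  have risk_le: "risk n \<le> 1" for n
    unfolding risk_def
  proof (rule SUP_least)
    fix \<mu> assume "\<mu> \<in> orlicz_class \<psi>"
    then have "prob_space (\<Pi>\<^sub>M i\<in>{1..n}. \<mu>)"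
      by (intro prob_space_PiM) (auto simp: orlicz_class_def)
    then show "emeasure (\<Pi>\<^sub>M i\<in>{1..n}. \<mu>) (bad n \<mu>) \<le> 1"
      by (intro subprob_space.subprob_emeasure_le_1 prob_space_imp_subprob_space)
  qed
  have risk_ge: "1 \<le> risk n" if r: "r n < 1 / 4" for n
  proof (rule ennreal_le_epsilon)
    fix e :: real assume e: "e > 0"
    \<comment> \<open>The bound \<open>n / e\<close> keeps the chance of seeing any nonzero
      observation among \<open>n\<close> draws at most \<open>e\<close>.\<close>
    have "\<forall>\<^sub>F y in at_top. y > 0 \<and> \<psi> y \<ge> max 1 (real n / e)"
      using assms(1) eventually_gt_at_top[of 0]
      by (auto simp: orlicz_function_def filterlim_at_top eventually_conj_iff)
    then obtain y where y: "y > 0" "\<psi> y \<ge> 1" "real n / e \<le> \<psi> y"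
      by (auto simp: eventually_at_top_linorder)
    let ?z = "\<lambda>i\<in>{1..n}. 0 :: real"
    \<comment> \<open>The candidates \<open>1 / 2\<close> and \<open>1\<close> are
      \<open>1 / 2\<close> apart, so no single value lies within \<open>r n < 1 / 4\<close> of both.
      The choice of \<open>s\<close> depends only on the estimate at the zero sample.\<close>
    have "\<bar>est n ?z - 1 / 2\<bar> > r n \<or> \<bar>est n ?z - 1\<bar> > r n"
      using r by linarith
    then obtain s where "s = 1 / 2 \<or> s = 1" and s_far: "\<bar>est n ?z - s\<bar> > r n"
      by blast
    then have s: "0 < s" "s \<le> 1"
      by auto
    let ?\<mu> = "two_point_law (1 / \<psi> y) (s * y)"
    let ?P = "\<Pi>\<^sub>M i\<in>{1..n}. ?\<mu>"
    have norm: "orlicz_norm \<psi> ?\<mu> (\<lambda>x. x) = ennreal s"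
      using assms(1) y s by (intro orlicz_norm_two_point_law)
    have mem: "?\<mu> \<in> orlicz_class \<psi>"
      using s norm by (simp add: orlicz_class_def prob_space_two_point_law sets_two_point_law)
    have "?z \<in> space ?P"
      by (simp add: space_PiM two_point_law_def)
    have "sets ?P = sets (\<Pi>\<^sub>M i\<in>{1..n}. borel)"
      by (intro sets_PiM_cong) (auto simp: sets_two_point_law)
    then have [measurable]: "est n \<in> borel_measurable ?P"
      using assms(2)[of n] by (simp cong: measurable_cong_sets)
    have "bad n ?\<mu> \<in> sets ?P"
      unfolding bad_def by measurable
    moreover have "?z \<in> bad n ?\<mu>"
      using \<open>?z \<in> space ?P\<close> s s_far norm by (simp add: bad_def)
    ultimately have "ennreal (1 - real (card {1..n}) * (1 / \<psi> y)) \<le> emeasure ?P (bad n ?\<mu>)"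
      using y s by (intro ennreal_one_minus_le_emeasure_PiM_two_point_law) auto
    also have "\<dots> \<le> risk n"
      unfolding risk_def using mem by (intro SUP_upper)
    finally have *: "ennreal (1 - real n / \<psi> y) \<le> risk n"
      by simp
    have "real n / \<psi> y \<le> e"
      using y e by (simp add: field_simps)
    then have "ennreal 1 \<le> ennreal (1 - real n / \<psi> y + e)"
      by (intro ennreal_leI) simp
    \<comment> \<open>\<open>ennreal\<close> sends negative reals to \<open>0\<close>, hence the
      case split; in the negative case the term \<open>ennreal e\<close> alone suffices.\<close>
    also have "\<dots> \<le> ennreal (1 - real n / \<psi> y) + ennreal e"
      using e by (cases "0 \<le> 1 - real n / \<psi> y") (auto simp: ennreal_neg intro!: ennreal_leI)
    also have "\<dots> \<le> risk n + ennreal e"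
      using * by (intro add_right_mono)
    finally show "1 \<le> risk n + ennreal e"
      by simp
  qed
  \<comment> \<open>The rate enters only here: the risk is exactly \<open>1\<close> as soon as
    \<open>r n\<close> drops below \<open>1 / 4\<close>, so the limsup is even a limit.\<close>
  have "\<forall>\<^sub>F n in sequentially. r n < 1 / 4"
    using assms(3) by (rule order_tendstoD) simp
  then have "\<forall>\<^sub>F n in sequentially. risk n = 1"
    by eventually_elim (intro antisym risk_le risk_ge)
  then have "limsup risk = 1"
    by (intro lim_imp_Limsup tendsto_eventually) auto
  then show ?thesis
    by (simp add: risk_def[abs_def] bad_def)
qed

end
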